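(* There is a constant $C>0$ such that for all sufficiently large integers $k$, every deterministic online algorithm for the problem restricted to instances in which all jobs have unit weight ($w_j=1$) and processing time at most $k$ has competitive ratio at least $C\log k/\log\log k$. That is, the deterministic competitive ratio is $\Omega(\log k/\log\log k)$.
   Context: Model: online preemptive scheduling on a single machine (preemption with resume) in discrete time. Each job $j$ has an integer release time $r_j$, integer processing time $p_j\ge1$, integer deadline $d_j$ and weight $w_j$; job $j$ becomes known to the algorithm only at time $r_j$. At each integer time $t$ the machine processes at most one unit of one job, occupying $[t,t+1)$; a job is completed on time if it receives $p_j$ units of processing at integer times $t$ with $r_j\le t<d_j$. $\mathrm{ALG}(I)$ is the total weight of jobs the algorithm completes on time on instance $I$; $\mathrm{OPT}(I)$ is the maximum total weight achievable by an offline schedule. The competitive ratio of an algorithm is the infimum of $R$ such that $\mathrm{OPT}(I)\le R\cdot\mathrm{ALG}(I)$ for all instances $I$. *)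

theory Defs
  imports Complex_Main "HOL-Library.Extended_Real"
begin

text \<open>The label only serves to let an instance (a set) contain several jobs with equal parameters.\<close>

record job =
  label :: nat
  release :: int
  proc_time :: nat
  deadline :: int
  weight :: real

definition is_instance :: "job set \<Rightarrow> bool" where
  "is_instance I \<longleftrightarrow> finite I \<and> (\<forall>j\<in>I. 1 \<le> proc_time j)"

text \<open>
  \<open>S t = Some j\<close> means that the machine works on \<open>j\<close> during \<open>[t, t + 1)\<close>; \<open>None\<close> means that it
  is idle. A slot spent on a job outside the instance, before its release or after its deadline
  contributes nothing, so it amounts to idling and need not be excluded.
\<close>

type_synonym schedule = "int \<Rightarrow> job option"

definition completed_on_time :: "schedule \<Rightarrow> job \<Rightarrow> bool" where
  "completed_on_time S j \<longleftrightarrow>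
     proc_time j \<le> card {t. release j \<le> t \<and> t < deadline j \<and> S t = Some j}"

definition total_weight :: "job set \<Rightarrow> schedule \<Rightarrow> real" where
  "total_weight I S = (\<Sum>j | j \<in> I \<and> completed_on_time S j. weight j)"

definition OPT :: "job set \<Rightarrow> real" where
  "OPT I = Max (range (total_weight I))"

lemma finite_range_total_weight:
  assumes "finite I"
  shows "finite (range (total_weight I))"
proof (rule finite_subset)
  show "range (total_weight I) \<subseteq> sum weight ` Pow I"
    unfolding total_weight_def by auto
  show "finite (sum weight ` Pow I)"
    using assms by simp
qed

text \<open>
  A deterministic online algorithm chooses the job for slot \<open>t\<close> from \<open>t\<close> and the set of jobs
  released up to time \<open>t\<close>. Its earlier choices need not be an argument: they are determined by
  the same data, since release times are part of a job.
\<close>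

type_synonym online_algorithm = "int \<Rightarrow> job set \<Rightarrow> job option"

definition online_schedule :: "online_algorithm \<Rightarrow> job set \<Rightarrow> schedule" where
  "online_schedule A I = (\<lambda>t. A t {j \<in> I. release j \<le> t})"

definition ALG :: "online_algorithm \<Rightarrow> job set \<Rightarrow> real" where
  "ALG A I = total_weight I (online_schedule A I)"

text \<open>Taken in the extended reals, so that the ratio is \<open>\<infinity>\<close> if no \<open>R\<close> is admissible.\<close>

definition competitive_ratio :: "online_algorithm \<Rightarrow> job set set \<Rightarrow> ereal" where
  "competitive_ratio A \<I> = Inf {ereal R |R. \<forall>I\<in>\<I>. OPT I \<le> R * ALG A I}"

definition unit_weight_instances :: "nat \<Rightarrow> job set set" where
  "unit_weight_instances k =
     {I. is_instance I \<and> (\<forall>j\<in>I. weight j = 1 \<and> proc_time j \<le> k)}"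

end

theory Submission
  imports Defs "HOL-Real_Asymp.Real_Asymp"
begin

text \<open>
  The adversary plays in nested windows of lengths \<open>X = 3 n x\<close>, \<open>x\<close>, and so on. In a window of
  length \<open>X\<close> it releases a main job of length \<open>X - x\<close>, so that \<open>x\<close> is exactly the slack of this
  job, and then up to \<open>n\<close> consecutive tight jobs (baits) of length \<open>2 x + 1\<close>. If the algorithm never
  spends the first \<open>x + 1\<close> slots of a bait entirely on it, it misses all \<open>n\<close> baits and completes at
  most the main job, whereas an offline schedule completes all baits. If it does so for some bait,
  the main job is lost to the algorithm, but an offline schedule can still complete it without
  using the remaining \<open>x\<close> slots of the bait; these form the next window. To complete that bait
  the algorithm must give up everything released in the next window. Hence it completes at most
  one job in total, while the offline schedule gets \<open>n\<close> baits or one main job per level. With \<open>n\<close>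
  levels all lengths are at most \<open>(3 n) ^ n\<close>, which is at most \<open>k\<close> for \<open>n\<close> about
  \<open>ln k / (2 ln (ln k))\<close>.
\<close>

section \<open>Criteria for completion on time\<close>

lemma completed_on_time_cong:
  assumes "\<And>t. release j \<le> t \<Longrightarrow> t < deadline j \<Longrightarrow> S t = S' t"
  shows "completed_on_time S j \<longleftrightarrow> completed_on_time S' j"
proof -
  have "{t. release j \<le> t \<and> t < deadline j \<and> S t = Some j} =
        {t. release j \<le> t \<and> t < deadline j \<and> S' t = Some j}"
    using assms by auto
  then show ?thesis by (simp add: completed_on_time_def)
qed

lemma completed_on_time_processed:
  assumes "completed_on_time S j" "1 \<le> proc_time j"
  obtains t where "release j \<le> t" "t < deadline j" "S t = Some j"
proof -
  have "card {t. release j \<le> t \<and> t < deadline j \<and> S t = Some j} \<noteq> 0"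
    using assms by (simp add: completed_on_time_def)
  then have "{t. release j \<le> t \<and> t < deadline j \<and> S t = Some j} \<noteq> {}"
    by (metis card.empty)
  with that show ?thesis by blast
qed

lemma completed_on_timeI:
  assumes "\<And>t. t \<in> A \<Longrightarrow> release j \<le> t \<and> t < deadline j \<and> S t = Some j"
    and "proc_time j \<le> card A"
  shows "completed_on_time S j"
proof -
  have "finite {t. release j \<le> t \<and> t < deadline j \<and> S t = Some j}"
    by (rule finite_subset[of _ "{release j..<deadline j}"]) auto
  then have "card A \<le> card {t. release j \<le> t \<and> t < deadline j \<and> S t = Some j}"
    by (rule card_mono) (use assms(1) in auto)
  with assms(2) show ?thesis by (simp add: completed_on_time_def)
qed

text \<open>Counting: the slots in \<open>A\<close> and those given to \<open>j\<close> are disjoint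
  parts of the interval from release to deadline, so \<open>A\<close> only has to exceed the slack
  of \<open>j\<close>.\<close>

lemma not_completed_on_timeI:
  assumes "\<And>t. t \<in> A \<Longrightarrow> release j \<le> t \<and> t < deadline j \<and> S t \<noteq> Some j"
    and "nat (deadline j - release j) < proc_time j + card A"
  shows "\<not> completed_on_time S j"
proof
  assume "completed_on_time S j"
  define B where "B = {t. release j \<le> t \<and> t < deadline j \<and> S t = Some j}"
  have fin: "finite A" "finite B"
    by (rule finite_subset[of _ "{release j..<deadline j}"]; use assms(1) in \<open>auto simp: B_def\<close>)+
  have "card A + card B = card (A \<union> B)"
    using fin assms(1) by (subst card_Un_disjoint) (auto simp: B_def)
  also have "\<dots> \<le> card {release j..<deadline j}"
    by (rule card_mono) (use assms(1) in \<open>auto simp: B_def\<close>)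
  also have "\<dots> = nat (deadline j - release j)" by simp
  finally have "card B < proc_time j" using assms(2) by linarith
  with \<open>completed_on_time S j\<close> show False by (simp add: completed_on_time_def B_def)
qed

section \<open>Adversarial jobs and the nested strategy\<close>

definition main_job :: "int \<Rightarrow> nat \<Rightarrow> nat \<Rightarrow> job" where
  "main_job r X x =
     \<lparr>label = 0, release = r, proc_time = X - x, deadline = r + int X, weight = 1\<rparr>"

definition tight_job :: "int \<Rightarrow> nat \<Rightarrow> job" where
  "tight_job r p =
     \<lparr>label = 1, release = r, proc_time = p, deadline = r + int p, weight = 1\<rparr>"

lemma main_job_simps [simp]:
  "release (main_job r X x) = r" "proc_time (main_job r X x) = X - x"
  "deadline (main_job r X x) = r + int X" "weight (main_job r X x) = 1"
  by (simp_all add: main_job_def)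

lemma tight_job_simps [simp]:
  "release (tight_job r p) = r" "proc_time (tight_job r p) = p"
  "deadline (tight_job r p) = r + int p" "weight (tight_job r p) = 1"
  by (simp_all add: tight_job_def)

text \<open>The labels 0 and 1 ensure this even when all other parameters agree.\<close>

lemma main_job_neq_tight_job [simp]:
  "main_job r X x \<noteq> tight_job r' p" "tight_job r' p \<noteq> main_job r X x"
  by (simp_all add: main_job_def tight_job_def)

lemma tight_job_eq_iff [simp]: "tight_job r p = tight_job r' p' \<longleftrightarrow> r = r' \<and> p = p'"
  by (auto simp: tight_job_def)

text \<open>Without slack a single missed slot is fatal.\<close>

lemma completed_on_time_tight_job_iff:
  "completed_on_time S (tight_job r p) \<longleftrightarrow>
     (\<forall>t. r \<le> t \<longrightarrow> t < r + int p \<longrightarrow> S t = Some (tight_job r p))"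
proof
  assume comp: "completed_on_time S (tight_job r p)"
  show "\<forall>t. r \<le> t \<longrightarrow> t < r + int p \<longrightarrow> S t = Some (tight_job r p)"
  proof (rule ccontr)
    assume "\<not> ?thesis"
    then obtain t where "r \<le> t" "t < r + int p" "S t \<noteq> Some (tight_job r p)" by blast
    then have "\<not> completed_on_time S (tight_job r p)"
      by (intro not_completed_on_timeI[of "{t}"]) auto
    with comp show False by blast
  qed
next
  assume "\<forall>t. r \<le> t \<longrightarrow> t < r + int p \<longrightarrow> S t = Some (tight_job r p)"
  then show "completed_on_time S (tight_job r p)"
    by (intro completed_on_timeI[of "{r..<r + int p}"]) auto
qed

text \<open>
  \<open>I\<close> is what has been released before time \<open>r\<close>, \<open>N\<close> what is released in the window
  \<open>[r, r + X)\<close>.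
\<close>

definition adversary_wins ::
    "online_algorithm \<Rightarrow> nat \<Rightarrow> nat \<Rightarrow> int \<Rightarrow> job set \<Rightarrow> job set \<Rightarrow> bool" where
  "adversary_wins A m X r I N \<longleftrightarrow>
     finite N \<and>
     (\<forall>j\<in>N. r \<le> release j \<and> deadline j \<le> r + int X \<and> weight j = 1 \<and>
            1 \<le> proc_time j \<and> proc_time j \<le> X) \<and>
     card {j \<in> N. completed_on_time (online_schedule A (I \<union> N)) j} \<le> 1 \<and>
     (\<exists>T. m \<le> card {j \<in> N. completed_on_time T j})"

text \<open>One level of the nesting. The factor 3 in \<open>X\<close> makes room for
  \<open>n\<close> baits, as \<open>2 * x + 1 \<le> 3 * x\<close>. The inner strategy is assumed for
  every \<open>r\<close> and \<open>I\<close> because start and past of the inner window depend on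
  which bait is taken. The minimum reflects the two outcomes: \<open>n\<close> baits, or one main
  job on top of the inner \<open>m\<close>.\<close>

lemma adversary_step:
  fixes n x X :: nat and A :: online_algorithm
  assumes IH: "\<And>r I. \<forall>j\<in>I. release j < r \<Longrightarrow> \<exists>N. adversary_wins A m x r I N"
    and I: "\<forall>j\<in>I. release j < r"
    and x: "1 \<le> x" and n: "1 \<le> n" and X: "X = 3 * n * x"
  shows "\<exists>N. adversary_wins A (min n (Suc m)) X r I N"
proof -
  \<comment> \<open>The first \<open>x + 1\<close> slots exceed the slack of the main job by one;
    the last \<open>x\<close> slots are the inner window.\<close>
  define p where "p = 2 * x + 1"
  define s where "s i = r + int (i * p)" for i
  define J where "J = main_job r X x"
  define b where "b i = tight_job (s i) p" for i
  define K where "K i = insert J (b ` {..i})" for i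
  \<comment> \<open>The test involves only \<open>I \<union> K i\<close>, the jobs known before the
    inner window opens, so it does not depend on what the adversary releases afterwards.\<close>
  define bite where "bite i \<longleftrightarrow> (\<forall>t. s i \<le> t \<longrightarrow> t \<le> s i + int x \<longrightarrow> A t (I \<union> K i) = Some (b i))" for i

  have p: "1 \<le> p" "x < p" by (auto simp: p_def)
  have "n * p \<le> n * (3 * x)" using x by (intro mult_le_mono2) (simp add: p_def)
  then have npX: "n * p \<le> X" by (simp add: X)
  have s_Suc: "s (Suc i) = s i + int p" for i by (simp add: s_def algebra_simps)
  have s_mono: "s i \<le> s l \<longleftrightarrow> i \<le> l" for i l
    using p by (simp add: s_def flip: of_nat_mult)
  have s_ge: "r \<le> s i" for i by (simp add: s_def)
  have s_end: "s i + int p \<le> r + int X" if "i < n" for i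
  proof -
    have "Suc i * p \<le> n * p" using that by (intro mult_le_mono1) simp
    also note npX
    finally have "int (Suc i * p) \<le> int X" by (simp only: of_nat_le_iff)
    then show ?thesis by (simp add: s_def algebra_simps)
  qed
  have b_inj: "inj b" using p by (auto simp: inj_on_def b_def s_def)
  have "1 * p \<le> n * p" using n by (intro mult_le_mono1)
  with npX have pX: "p \<le> X" by linarith
  with p have xX: "x < X" by simp
  have K_props: "r \<le> release j \<and> deadline j \<le> r + int X \<and> weight j = 1 \<and>
            1 \<le> proc_time j \<and> proc_time j \<le> X" if "j \<in> K i" "i < n" for i j
  proof (cases "j = J")
    case True
    then show ?thesis using xX by (simp add: J_def)
  next
    case False
    with that obtain l where l: "l \<le> i" "j = b l" by (auto simp: K_def)
    then show ?thesis using l that s_end[of l] s_ge[of l] p pX by (simp add: b_def)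
  qed

  \<comment> \<open>During bait \<open>l\<close> neither the later baits nor \<open>N'\<close> have
    been released. Hence the values of \<open>A\<close> used in \<open>bite\<close> are the actual
    choices on the final instance.\<close>
  have visible: "online_schedule A (I \<union> K i \<union> N') t = A t (I \<union> K l)"
    if "l \<le> i" "s l \<le> t" "t < s l + int p" "\<forall>j\<in>N'. t < release j" for i l t N'
  proof -
    have "{j \<in> I \<union> K i \<union> N'. release j \<le> t} = I \<union> K l"
    proof (intro equalityI subsetI)
      fix j assume j: "j \<in> {j \<in> I \<union> K i \<union> N'. release j \<le> t}"
      show "j \<in> I \<union> K l"
      proof (cases "j \<in> I \<or> j = J")
        case False
        with j \<open>\<forall>j\<in>N'. t < release j\<close> obtain q where q: "j = b q" "s q \<le> t" by (force simp: K_def b_def)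
        then have "s q < s (Suc l)" using that by (simp add: s_Suc)
        then have "q \<le> l" using s_mono[of "Suc l" q] by linarith
        then show ?thesis using q by (auto simp: K_def)
      qed (auto simp: K_def)
    next
      fix j assume "j \<in> I \<union> K l"
      then consider "j \<in> I" | "j = J" | q where "q \<le> l" "j = b q" by (auto simp: K_def)
      then show "j \<in> {j \<in> I \<union> K i \<union> N'. release j \<le> t}"
      proof cases
        case 1
        then show ?thesis using I s_ge[of l] that by force
      next
        case 2
        then show ?thesis using s_ge[of l] that by (auto simp: K_def J_def)
      next
        case 3
        then have "s q \<le> t" using s_mono[of q l] that by simp
        with 3 that show ?thesis by (auto simp: K_def b_def)
      qed
    qed
    then show ?thesis by (simp add: online_schedule_def)
  qed
  have ignored: "\<not> completed_on_time (online_schedule A (I \<union> K i \<union> N')) (b l)"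
    if "l \<le> i" "\<not> bite l" "\<forall>j\<in>N'. s l + int x < release j" for i l N'
  proof -
    obtain t where t: "s l \<le> t" "t \<le> s l + int x" "A t (I \<union> K l) \<noteq> Some (b l)"
      using \<open>\<not> bite l\<close> by (auto simp: bite_def)
    have "online_schedule A (I \<union> K i \<union> N') t = A t (I \<union> K l)"
      by (rule visible) (use t that p in force)+
    with t p show ?thesis by (force simp: b_def completed_on_time_tight_job_iff)
  qed

  show ?thesis
  proof (cases "\<exists>i<n. bite i")
    case False
    define N where "N = K (n - 1)"
    have "{j \<in> N. completed_on_time (online_schedule A (I \<union> N)) j} \<subseteq> {J}"
    proof
      fix j assume "j \<in> {j \<in> N. completed_on_time (online_schedule A (I \<union> N)) j}"
      moreover have "\<not> completed_on_time (online_schedule A (I \<union> N)) (b l)" if "l \<le> n - 1" for l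
        using ignored[of l "n - 1" "{}"] that False n by (auto simp: N_def)
      ultimately show "j \<in> {J}" by (auto simp: N_def K_def)
    qed
    then have alg: "card {j \<in> N. completed_on_time (online_schedule A (I \<union> N)) j} \<le> 1"
      using card_mono[of "{J}"] by simp
    \<comment> \<open>The baits lie back to back from \<open>r\<close> on, so this division finds
      the bait to which slot \<open>t\<close> belongs. Values outside the window are
      irrelevant.\<close>
    define T where "T t = Some (b (nat ((t - r) div int p)))" for t
    have "completed_on_time T (b i)" for i
    proof -
      have "(t - r) div int p = int i" if "s i \<le> t" "t < s i + int p" for t
      proof (rule int_div_pos_eq)
        show "t - r = int p * int i + (t - s i)" by (simp add: s_def)
      qed (use that in auto)
      then show ?thesis
        by (simp add: b_def completed_on_time_tight_job_iff T_def)
    qed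
    then have "b ` {..<n} \<subseteq> {j \<in> N. completed_on_time T j}" using n by (auto simp: N_def K_def)
    moreover have "finite N" by (simp add: N_def K_def)
    ultimately have "card (b ` {..<n}) \<le> card {j \<in> N. completed_on_time T j}"
      by (intro card_mono) auto
    then have "min n (Suc m) \<le> card {j \<in> N. completed_on_time T j}"
      using b_inj by (simp add: card_image inj_on_subset)
    with alg \<open>finite N\<close> K_props[of _ "n - 1"] n show ?thesis
      unfolding adversary_wins_def by (intro exI[of _ N]) (auto simp: N_def)
  next
    case True
    \<comment> \<open>Taking the first bait that is bitten guarantees that all earlier ones are lost
      to the algorithm.\<close>
    define i where "i = (LEAST i. i < n \<and> bite i)"
    have i: "i < n" "bite i" using LeastI_ex[OF True] by (auto simp: i_def)
    have before: "\<not> bite l" if "l < i" for l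
      using not_less_Least[of l "\<lambda>i. i < n \<and> bite i"] that i by (auto simp: i_def)
    \<comment> \<open>The inner window starts right after the \<open>x + 1\<close> committed slots
      and ends exactly at the deadline of bait \<open>i\<close>.\<close>
    define r' where "r' = s i + int x + 1"
    have r'_end: "r' + int x = s i + int p" by (simp add: r'_def p_def)
    have rel: "\<forall>j\<in>I \<union> K i. release j < r'"
      using I s_ge[of i] s_mono[of _ i] by (force simp: K_def J_def b_def r'_def)
    from IH[OF this] obtain N' T where N': "finite N'"
      "\<And>j. j \<in> N' \<Longrightarrow> r' \<le> release j \<and> deadline j \<le> r' + int x \<and> weight j = 1 \<and>
            1 \<le> proc_time j \<and> proc_time j \<le> x"
      "card {j \<in> N'. completed_on_time (online_schedule A (I \<union> K i \<union> N')) j} \<le> 1"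
      "m \<le> card {j \<in> N'. completed_on_time T j}"
      unfolding adversary_wins_def by blast
    define N where "N = K i \<union> N'"
    define S where "S = online_schedule A (I \<union> K i \<union> N')"
    have S: "online_schedule A (I \<union> N) = S" by (simp add: S_def N_def Un_assoc)
    have disj: "j \<notin> N'" if "j \<in> K i" for j using N'(2)[of j] rel that by force
    have finN: "finite N" using N'(1) by (simp add: N_def K_def)
    have bitten: "S t = Some (b i)" if "s i \<le> t" "t < r'" for t
    proof -
      have "S t = A t (I \<union> K i)"
        unfolding S_def by (rule visible) (use that N'(2) r'_end in force)+
      with i that show ?thesis by (simp add: bite_def r'_def)
    qed
    \<comment> \<open>The committed slots number \<open>x + 1\<close>, one more than the slack of
      \<open>J\<close>.\<close>
    have J_dead: "\<not> completed_on_time S J"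
    proof (rule not_completed_on_timeI[of "{s i..<r'}"])
      show "release J \<le> t \<and> t < deadline J \<and> S t \<noteq> Some J" if "t \<in> {s i..<r'}" for t
        using that bitten[of t] s_ge[of i] s_end[OF i(1)] r'_end by (auto simp: J_def b_def)
    qed (use xX in \<open>simp add: J_def r'_def\<close>)
    have K_dead: "j = b i" if "j \<in> K i" "completed_on_time S j" for j
    proof (rule ccontr)
      assume "j \<noteq> b i"
      with that J_dead obtain l where l: "l < i" "j = b l"
        by (auto simp: K_def le_less)
      have "s (Suc l) \<le> s i" using l s_mono by simp
      then have "\<forall>j\<in>N'. s l + int x < release j"
        using N'(2) p by (force simp: s_Suc r'_def)
      with ignored[of l i N'] before l that show False by (simp add: S_def)
    qed
    have "card {j \<in> N. completed_on_time S j} \<le> 1"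
    \<comment> \<open>Completing \<open>b i\<close> takes every slot of the inner window, so nothing
      in \<open>N'\<close> is processed in time. Otherwise all of \<open>K i\<close> is lost and the
      inner bound applies.\<close>
    proof (cases "completed_on_time S (b i)")
      case True
      have "\<not> completed_on_time S j" if "j \<in> N'" for j
      proof
        assume "completed_on_time S j"
        with N'(2)[OF that] obtain t where t: "release j \<le> t" "t < deadline j" "S t = Some j"
          by (auto elim: completed_on_time_processed)
        then have "S t = Some (b i)"
          using True N'(2)[OF that] r'_end
          by (auto simp: b_def completed_on_time_tight_job_iff r'_def)
        with t have "j = b i" by simp
        with disj[of "b i"] that show False by (simp add: K_def)
      qed
      then have "{j \<in> N. completed_on_time S j} \<subseteq> {b i}" using K_dead by (auto simp: N_def)
      then show ?thesis using card_mono[of "{b i}"] by simp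
    next
      case False
      then have "{j \<in> N. completed_on_time S j} = {j \<in> N'. completed_on_time S j}"
        using K_dead by (auto simp: N_def)
      with N'(3) show ?thesis by (simp add: S_def)
    qed
    moreover have "\<exists>T. min n (Suc m) \<le> card {j \<in> N. completed_on_time T j}"
    proof -
      \<comment> \<open>All baits are dropped. The slots outside the inner window give
        \<open>J\<close> exactly the \<open>X - x\<close> units it needs, and the jobs of
        \<open>N'\<close> only see slots where \<open>T'\<close> agrees with
        \<open>T\<close>.\<close>
      define T' where "T' t = (if r' \<le> t \<and> t < r' + int x then T t else Some J)" for t
      have "completed_on_time T' J"
      proof (rule completed_on_timeI[of "{r..<r + int X} - {r'..<r' + int x}"])
        have "{r'..<r' + int x} \<subseteq> {r..<r + int X}"
          using s_ge[of i] s_end[OF i(1)] r'_end by (auto simp: r'_def)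
        then show "proc_time J \<le> card ({r..<r + int X} - {r'..<r' + int x})"
          by (simp add: card_Diff_subset J_def)
      qed (auto simp: T'_def J_def)
      moreover have "completed_on_time T' j \<longleftrightarrow> completed_on_time T j" if "j \<in> N'" for j
        using N'(2)[OF that] by (intro completed_on_time_cong) (auto simp: T'_def)
      ultimately have "insert J {j \<in> N'. completed_on_time T j} \<subseteq> {j \<in> N. completed_on_time T' j}"
        by (auto simp: N_def K_def)
      then have "card (insert J {j \<in> N'. completed_on_time T j}) \<le> card {j \<in> N. completed_on_time T' j}"
        using finN by (intro card_mono) auto
      moreover have "J \<notin> N'" using disj[of J] by (simp add: K_def)
      ultimately have "Suc m \<le> card {j \<in> N. completed_on_time T' j}"
        using N'(1,4) by simp
      then show ?thesis by (intro exI[of _ T']) simp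
    qed
    moreover have "r \<le> release j \<and> deadline j \<le> r + int X \<and> weight j = 1 \<and>
            1 \<le> proc_time j \<and> proc_time j \<le> X" if "j \<in> N" for j
    proof (cases "j \<in> K i")
      case False
      with that have "j \<in> N'" by (simp add: N_def)
      from N'(2)[OF this] show ?thesis
        using s_ge[of i] s_end[OF i(1)] r'_end xX by (auto simp: r'_def)
    qed (use K_props i in blast)
    ultimately show ?thesis
      unfolding adversary_wins_def using finN S by (intro exI[of _ N]) auto
  qed
qed

text \<open>Induction on the depth \<open>d\<close>, starting from a window of length 1 in which
  nothing is released. The cap \<open>n\<close> comes from the outcome in which no bait is
  taken.\<close>

lemma adversary_strategy:
  assumes "1 \<le> n" "\<forall>j\<in>I. release j < r"
  shows "\<exists>N. adversary_wins A (min n d) ((3 * n) ^ d) r I N"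
  using assms(2)
proof (induction d arbitrary: r I)
  case 0
  show ?case by (intro exI[of _ "{}"]) (simp add: adversary_wins_def)
next
  case (Suc d)
  have "\<exists>N. adversary_wins A (min n (Suc (min n d))) ((3 * n) ^ Suc d) r I N"
    by (rule adversary_step[OF Suc.IH Suc.prems]) (use assms(1) in auto)
  moreover have "min n (Suc (min n d)) = min n (Suc d)" by simp
  ultimately show ?case by metis
qed

section \<open>From the strategy to the competitive ratio\<close>

lemma competitive_ratio_ge:
  assumes n: "1 \<le> n" and k: "(3 * n) ^ n \<le> k"
  shows "competitive_ratio A (unit_weight_instances k) \<ge> ereal (real n)"
proof -
  \<comment> \<open>At depth \<open>n\<close> the guarantee \<open>min n n\<close> is
    \<open>n\<close>; the game starts at time 0 with an empty past.\<close>
  obtain N where N: "adversary_wins A n ((3 * n) ^ n) 0 {} N"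
    using adversary_strategy[OF n, of "{}" 0 A n] by auto
  then obtain T where T: "n \<le> card {j \<in> N. completed_on_time T j}"
    by (auto simp: adversary_wins_def)
  have fin: "finite N" and w: "\<And>j. j \<in> N \<Longrightarrow> weight j = 1"
    using N by (auto simp: adversary_wins_def)
  have inst: "N \<in> unit_weight_instances k"
    using N k by (force simp: adversary_wins_def unit_weight_instances_def is_instance_def)
  have tw: "total_weight N S = real (card {j \<in> N. completed_on_time S j})" for S
    using w by (simp add: total_weight_def)
  have "real n \<le> total_weight N T" using T by (simp add: tw)
  also have "\<dots> \<le> OPT N"
    unfolding OPT_def using finite_range_total_weight[OF fin] by (intro Max_ge) auto
  finally have opt: "real n \<le> OPT N" .
  have alg: "0 \<le> ALG A N" "ALG A N \<le> 1"
    using N by (simp_all add: ALG_def tw adversary_wins_def)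
  have "real n \<le> R" if "\<forall>I\<in>unit_weight_instances k. OPT I \<le> R * ALG A I" for R
  proof -
    have le: "real n \<le> R * ALG A N" using that inst opt by force
    \<comment> \<open>For \<open>R \<le> 0\<close> the product would be at most 0, below
      \<open>n\<close>. Positivity then gives \<open>R * ALG A N \<le> R\<close>, also when
      \<open>ALG A N\<close> is 0.\<close>
    moreover have "0 < R"
      using le n alg(1) mult_nonpos_nonneg[of R "ALG A N"] by linarith
    ultimately show ?thesis using alg(2) mult_left_le[of "ALG A N" R] by linarith
  qed
  then show ?thesis
    unfolding competitive_ratio_def by (intro Inf_greatest) auto
qed

section \<open>Choice of the number of levels\<close>

theorem theorem5:
  "\<exists>C::real. C > 0 \<and>
     (\<forall>\<^sub>F k::nat in sequentially. \<forall>A::online_algorithm.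
        competitive_ratio A (unit_weight_instances k)
          \<ge> ereal (C * ln (real k) / ln (ln (real k))))"
\<comment> \<open>One factor 1/2 comes from the choice of \<open>n\<close> below, the other absorbs
  rounding down: \<open>L / (2 * ln L) - 1\<close> is at least \<open>L / (4 * ln L)\<close> once
  \<open>L / ln L \<ge> 4\<close>.\<close>
proof (intro exI[of _ "1 / 4"] conjI)
  have "\<forall>\<^sub>F k::nat in sequentially. ln (real k) / ln (ln (real k)) \<ge> 4"
    by real_asymp
  moreover have "\<forall>\<^sub>F k::nat in sequentially. ln (real k) \<ge> 3"
    by real_asymp
  moreover have "\<forall>\<^sub>F k::nat in sequentially. ln (ln (real k)) \<ge> 1"
    by real_asymp
  ultimately show "\<forall>\<^sub>F k::nat in sequentially. \<forall>A::online_algorithm.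
      competitive_ratio A (unit_weight_instances k)
        \<ge> ereal (1 / 4 * ln (real k) / ln (ln (real k)))"
  proof eventually_elim
    case (elim k)
    define L where "L = ln (real k)"
    \<comment> \<open>Chosen so that \<open>n * ln (3 * n) \<le> L\<close>: since
      \<open>3 * n \<le> 3 * L \<le> L * L\<close>, the logarithm is at most
      \<open>2 * ln L\<close>.\<close>
    define n where "n = nat \<lfloor>L / (2 * ln L)\<rfloor>"
    have L: "L \<ge> 3" "ln L \<ge> 1" "L / ln L \<ge> 4" using elim by (simp_all add: L_def)
    have n_le: "real n \<le> L / (2 * ln L)" using L by (simp add: n_def)
    have "real n \<ge> L / (2 * ln L) - 1" using L unfolding n_def by linarith
    then have n_ge: "real n \<ge> 1 / 4 * L / ln L" using L by (simp add: field_simps)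
    have n1: "1 \<le> n" using n_ge L by simp
    have "L / (2 * ln L) \<le> L" using L by (simp add: field_simps)
    then have "real (3 * n) \<le> L * L"
      using n_le L by (intro order_trans[OF _ mult_right_mono[of 3 L L]]) auto
    then have "ln (real (3 * n)) \<le> ln (L * L)" using n1 L by (subst ln_le_cancel_iff) auto
    also have "\<dots> = 2 * ln L" using L by (simp add: ln_mult)
    finally have "real n * ln (real (3 * n)) \<le> L / (2 * ln L) * (2 * ln L)"
      using n_le L n1 by (intro mult_mono) auto
    also have "\<dots> = L" using L by simp
    finally have "ln (real ((3 * n) ^ n)) \<le> ln (real k)"
      using n1 unfolding of_nat_power L_def by (subst ln_realpow) auto
    moreover have "0 < real k" using L by (cases "k = 0") (auto simp: L_def)
    ultimately have "real ((3 * n) ^ n) \<le> real k"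
      using n1 by (subst (asm) ln_le_cancel_iff) auto
    then have "(3 * n) ^ n \<le> k" by (simp only: of_nat_le_iff)
    show ?case
    proof
      fix A :: online_algorithm
      have "ereal (1 / 4 * ln (real k) / ln (ln (real k))) \<le> ereal (real n)"
        using n_ge by (simp add: L_def)
      also have "\<dots> \<le> competitive_ratio A (unit_weight_instances k)"
        by (rule competitive_ratio_ge) fact+
      finally show "competitive_ratio A (unit_weight_instances k)
        \<ge> ereal (1 / 4 * ln (real k) / ln (ln (real k)))" .
    qed
  qed
qed simp

end
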